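(* For each integer $n \geq 6$, $\mathrm{cms}(n,2)=\lfloor n/3\rfloor$, and for each even integer $n \geq 4$, $\mathrm{cms}_1(n,2)=\frac{n-2}{2}$.
   Context: All graphs are finite and simple. For a graph $G$ with $m$ edges, an ordering of $G$ is a bijection $\ell: E(G)\to\mathbb{Z}_m$. For distinct edges $e,e'$, the forward distance $d_\ell(e,e')$ is the smallest positive integer $d$ with $\ell(e)+d=\ell(e')$ in $\mathbb{Z}_m$, and $d_\ell\{e,e'\}=\min\{d_\ell(e,e'),d_\ell(e',e)\}$. Two edges are adjacent if they share a vertex. $\mathrm{cms}(\ell)$ is the largest $s\in\{1,\dots,m\}$ such that $d_\ell\{e,e'\}\geq s$ for every pair of adjacent edges; $\mathrm{cms}(G)$ is the maximum of $\mathrm{cms}(\ell)$ over all orderings of $G$. A $k$-regular graph is class 1 if its edges can be properly coloured with $k$ colours. $\mathrm{cms}(n,k)$ is the minimum of $\mathrm{cms}(G)$ over all $k$-regular graphs on $n$ vertices, and $\mathrm{cms}_1(n,k)$ is the minimum of $\mathrm{cms}(G)$ over all $k$-regular class 1 graphs on $n$ vertices. *)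

theory Defs
  imports Complex_Main "HOL-Number_Theory.Cong"
begin

definition simple_graph :: "'a set \<Rightarrow> 'a set set \<Rightarrow> bool" where
  "simple_graph V E \<longleftrightarrow> finite V \<and> (\<forall>e\<in>E. e \<subseteq> V \<and> card e = 2)"

definition degree :: "'a set set \<Rightarrow> 'a \<Rightarrow> nat" where
  "degree E v = card {e \<in> E. v \<in> e}"

definition regular_graph :: "nat \<Rightarrow> 'a set \<Rightarrow> 'a set set \<Rightarrow> bool" where
  "regular_graph k V E \<longleftrightarrow> simple_graph V E \<and> (\<forall>v\<in>V. degree E v = k)"

definition adjacent :: "'a set \<Rightarrow> 'a set \<Rightarrow> bool" where
  "adjacent e e' \<longleftrightarrow> e \<noteq> e' \<and> e \<inter> e' \<noteq> {}"

definition proper_edge_colouring :: "nat \<Rightarrow> 'a set set \<Rightarrow> ('a set \<Rightarrow> nat) \<Rightarrow> bool" where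
  "proper_edge_colouring k E c \<longleftrightarrow>
     c ` E \<subseteq> {..<k} \<and> (\<forall>e\<in>E. \<forall>e'\<in>E. adjacent e e' \<longrightarrow> c e \<noteq> c e')"

definition class1 :: "nat \<Rightarrow> 'a set \<Rightarrow> 'a set set \<Rightarrow> bool" where
  "class1 k V E \<longleftrightarrow> regular_graph k V E \<and> (\<exists>c. proper_edge_colouring k E c)"

text \<open>The cyclic group of order \<open>m = card E\<close> is represented by its residues \<open>{..<m}\<close>.\<close>

definition is_ordering :: "'a set set \<Rightarrow> ('a set \<Rightarrow> nat) \<Rightarrow> bool" where
  "is_ordering E l \<longleftrightarrow> bij_betw l E {..<card E}"

definition forward_dist :: "'a set set \<Rightarrow> ('a set \<Rightarrow> nat) \<Rightarrow> 'a set \<Rightarrow> 'a set \<Rightarrow> nat" where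
  "forward_dist E l e e' = (LEAST d. d > 0 \<and> [l e + d = l e'] (mod card E))"

definition cyclic_dist :: "'a set set \<Rightarrow> ('a set \<Rightarrow> nat) \<Rightarrow> 'a set \<Rightarrow> 'a set \<Rightarrow> nat" where
  "cyclic_dist E l e e' = min (forward_dist E l e e') (forward_dist E l e' e)"

definition cms_ordering :: "'a set set \<Rightarrow> ('a set \<Rightarrow> nat) \<Rightarrow> nat" where
  "cms_ordering E l =
     Max {s \<in> {1..card E}. \<forall>e\<in>E. \<forall>e'\<in>E. adjacent e e' \<longrightarrow> s \<le> cyclic_dist E l e e'}"

text \<open>There may be infinitely many functions \<open>l\<close> below (their values outside \<open>E\<close> are
  unconstrained), but the set of values is a finite nonempty subset of \<open>{1..card E}\<close>
  whenever \<open>E\<close> is finite and nonempty.\<close>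

definition cms_graph :: "'a set set \<Rightarrow> nat" where
  "cms_graph E = Max {cms_ordering E l | l. is_ordering E l}"

text \<open>Every finite graph is isomorphic to one whose vertices are natural numbers, so the
  minima below range over all graphs with \<open>n\<close> vertices up to isomorphism.  For \<open>k \<ge> 1\<close> the
  sets of values are finite; \<open>Min\<close> is meaningful only if a suitable graph exists.\<close>

definition cms :: "nat \<Rightarrow> nat \<Rightarrow> nat" where
  "cms n k = Min {cms_graph E | (V :: nat set) E. regular_graph k V E \<and> card V = n}"

definition cms1 :: "nat \<Rightarrow> nat \<Rightarrow> nat" where
  "cms1 n k = Min {cms_graph E | (V :: nat set) E. class1 k V E \<and> card V = n}"

end

theory Submission
  imports Defs "HOL-Library.Multiset"
begin

text \<open>The line graph of a 2-regular graph is a disjoint union of cycles. Number the \<open>n\<close> places of the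
  cyclic order as slots \<open>0, 1, 2, \<dots>\<close> that visit its three thirds in turn. Slots \<open>x < y\<close> are then at
  distance at least \<open>\<lfloor>n/3\<rfloor>\<close> whenever \<open>y - x\<close> is 1 modulo 3, so it suffices to place each cycle of
  edges on a block of consecutive slots such that neighbours take such pairs of slots. This is possible
  on any block for cycle lengths not divisible by three, except that 4-cycles have to be treated
  in pairs. Lengths divisible by three need one further step by two slots, which is harmless from a slot
  divisible by three, so these cycles come first. For class 1 graphs all cycles are even, and the same
  is done with two halves instead of three thirds, folding each cycle into a ladder.

  Conversely, the three edges of a triangle are pairwise adjacent, which bounds the distance by \<open>n/3\<close>;
  and an edge has two neighbours but at most one edge at distance \<open>n/2\<close>.\<close>

section \<open>Packing cycles into slots\<close>

definition cyclic_chain :: "('a \<Rightarrow> 'a \<Rightarrow> bool) \<Rightarrow> 'a list \<Rightarrow> bool" where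
  "cyclic_chain P xs \<longleftrightarrow> xs \<noteq> [] \<and> successively P xs \<and> P (last xs) (hd xs)"

lemma cyclic_chain_nth:
  assumes "cyclic_chain P xs" "i < length xs"
  shows "P (xs ! i) (xs ! (Suc i mod length xs))"
proof (cases "Suc i = length xs")
  case True
  then show ?thesis
    using assms by (auto simp: cyclic_chain_def last_conv_nth hd_conv_nth simp flip: True)
next
  case False
  then show ?thesis
    using assms by (auto simp: cyclic_chain_def successively_conv_nth)
qed

text \<open>The lists in \<open>ss\<close> split a block of consecutive slots starting at
  \<open>a\<close>; equality of multisets expresses disjointness and covering at once.
  \<open>M\<close> is a multiset because the cycles may be placed in any order.\<close>

definition fits :: "(nat \<Rightarrow> nat \<Rightarrow> bool) \<Rightarrow> nat multiset \<Rightarrow> nat \<Rightarrow> bool" where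
  "fits P M a \<longleftrightarrow> (\<exists>ss. mset (map length ss) = M \<and>
     mset (concat ss) = mset [a..<a + sum_mset M] \<and> (\<forall>c\<in>set ss. cyclic_chain P c))"

lemma fitsI:
  assumes "mset (map length ss) = M" "distinct (concat ss)"
    "set (concat ss) = {a..<a + sum_mset M}" "\<And>c. c \<in> set ss \<Longrightarrow> cyclic_chain P c"
  shows "fits P M a"
proof -
  have "mset (concat ss) = mset [a..<a + sum_mset M]"
    using assms(2,3) by (intro iffD1[OF set_eq_iff_mset_eq_distinct]) auto
  then show ?thesis
    using assms unfolding fits_def by blast
qed

lemma fits_empty: "fits P {#} a"
  unfolding fits_def by (intro exI[of _ "[]"]) auto

lemma fits_add:
  assumes "fits P M a" "fits P N (a + sum_mset M)"
  shows "fits P (M + N) a"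
proof -
  obtain ss where ss: "mset (map length ss) = M" "mset (concat ss) = mset [a..<a + sum_mset M]"
    "\<forall>c\<in>set ss. cyclic_chain P c"
    using assms(1) unfolding fits_def by blast
  obtain ts where ts: "mset (map length ts) = N"
    "mset (concat ts) = mset [a + sum_mset M..<a + sum_mset M + sum_mset N]"
    "\<forall>c\<in>set ts. cyclic_chain P c"
    using assms(2) unfolding fits_def by blast
  have "mset [a..<a + sum_mset (M + N)] = mset (concat (ss @ ts))"
    using ss(2) ts(2) upt_add_eq_append[of a "a + sum_mset M" "sum_mset N"]
    by (simp add: add.assoc)
  then show ?thesis
    using ss ts unfolding fits_def by (intro exI[of _ "ss @ ts"]) auto
qed

lemma fits_translate:
  assumes "fits P M 0" "\<And>x y. P x y \<Longrightarrow> Q (a + x) (a + y)"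
  shows "fits Q M a"
proof -
  obtain ss where ss: "mset (map length ss) = M" "mset (concat ss) = mset [0..<sum_mset M]"
    "\<forall>c\<in>set ss. cyclic_chain P c"
    using assms(1) unfolding fits_def by auto
  have "mset (concat (map (map ((+) a)) ss)) = mset (map ((+) a) (concat ss))"
    by (simp add: map_concat)
  also have "\<dots> = image_mset ((+) a) (mset [0..<sum_mset M])"
    using ss(2) by simp
  also have "\<dots> = mset [a..<a + sum_mset M]"
    using arg_cong[OF map_add_upt[of a "sum_mset M"], of mset]
    by (simp add: add.commute[of _ a])
  finally have "mset (concat (map (map ((+) a)) ss)) = mset [a..<a + sum_mset M]" .
  moreover have "cyclic_chain Q (map ((+) a) c)" if "cyclic_chain P c" for c
    using that assms(2)
    by (auto simp: cyclic_chain_def successively_map last_map hd_map intro: successively_mono)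
  ultimately show ?thesis
    using ss unfolding fits_def
    by (intro exI[of _ "map (map ((+) a)) ss"]) (auto simp: comp_def)
qed

text \<open>Slot \<open>s\<close> lies in the third number \<open>s mod 3\<close> of the cyclic order, at level \<open>s div 3\<close>. The
  parameter \<open>k\<close> counts the residues from which a step by two slots is harmless; for \<open>n\<close> edges it is
  \<open>n mod 3 + 1\<close>, because the first \<open>n mod 3\<close> thirds are longer by one.\<close>

definition slot3 :: "nat \<Rightarrow> nat \<Rightarrow> nat \<Rightarrow> bool" where
  "slot3 k x y \<longleftrightarrow>
     x < y \<and> ((y - x) mod 3 = 1 \<or> y = x + 2 \<and> x mod 3 < k) \<or>
     y < x \<and> ((x - y) mod 3 = 1 \<or> x = y + 2 \<and> y mod 3 < k)"

text \<open>\<open>slot3 0\<close> depends only on the difference of the two slots, so its patterns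
  can start anywhere.\<close>

lemma slot3_0_add: "slot3 0 x y \<Longrightarrow> slot3 k (a + x) (a + y)"
  unfolding slot3_def by auto

text \<open>A step by two depends on the residue of its smaller slot, which shifts by multiples of
  three preserve; a larger parameter allows more such steps.\<close>

lemma slot3_add: "slot3 j x y \<Longrightarrow> j \<le> k \<Longrightarrow> 3 dvd a \<Longrightarrow> slot3 k (a + x) (a + y)"
  unfolding slot3_def by (auto elim!: dvdE)

lemma slot3_Suc [simp]: "slot3 k x (Suc x)"
  unfolding slot3_def by simp

lemma successively_slot3_upt [simp]: "successively (slot3 k) [i..<j]"
  by (auto simp: successively_conv_nth)

lemmas chain_simps = cyclic_chain_def successively_append_iff successively_Cons hd_append
  last_append

section \<open>Explicit slot patterns for one, two or three cycles\<close>

text \<open>The step from 0 to 2 is the single one by two; it makes the closing difference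
  \<open>3 * q + 1\<close> instead of \<open>3 * q + 2\<close>.\<close>

lemma fits_residue_0:
  "fits (slot3 1) {#3 * q + 3#} 0"
proof (rule fitsI)
  show "cyclic_chain (slot3 1) c" if "c \<in> set [[1, 0] @ [2..<3 * q + 3]]" for c
    using that by (auto simp: chain_simps simp del: upt_Suc; simp add: slot3_def; presburger)
qed auto

text \<open>The ascending list closes because \<open>3 * q + 4\<close> is 1 modulo 3.\<close>

lemma fits_residue_2:
  "fits (slot3 0) {#3 * q + 5#} 0"
proof (rule fitsI)
  show "cyclic_chain (slot3 0) c" if "c \<in> set [[0..<3 * q + 5]]" for c
    using that by (auto simp: chain_simps simp del: upt_Suc; simp add: slot3_def; presburger)
qed auto

text \<open>The ascending list would close with a difference divisible by three. The order chosen
  uses differences 1 and 4 and, on the return to slot 5, \<open>3 * q + 1\<close>.\<close>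

lemma fits_residue_1:
  "fits (slot3 0) {#3 * q + 7#} 0"
proof (rule fitsI)
  show "cyclic_chain (slot3 0) c" if "c \<in> set [[1, 0, 4, 3, 2] @ [6..<3 * q + 7] @ [5]]" for c
    using that by (auto simp: chain_simps simp del: upt_Suc; simp add: slot3_def; presburger)
qed auto

text \<open>Within four consecutive slots \<open>slot3 0\<close> relates only neighbouring slots, so
  one 4-cycle does not close; two are interleaved with differences 1 and 4.\<close>

lemma fits_4_4: "fits (slot3 0) {#4, 4#} 0"
proof (rule fitsI)
  show "cyclic_chain (slot3 0) c" if "c \<in> set [[0, 1, 5, 4], [2, 3, 7, 6]]" for c
    using that by (auto simp: chain_simps slot3_def)
qed (auto simp: numeral_eq_Suc)

text \<open>The steps by two start at residues 0 and 1, hence the parameter 2.\<close>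

lemma fits_4: "fits (slot3 2) {#4#} 0"
proof (rule fitsI)
  show "cyclic_chain (slot3 2) c" if "c \<in> set [[0, 1, 3, 2]]" for c
    using that by (auto simp: chain_simps slot3_def)
qed auto

text \<open>A single step by two, from 0 to 2, lets the 4-cycle jump over slot 1, which the
  companion cycle takes. The two lemmas that follow use the same 4-cycle.\<close>

lemma fits_4_residue_2:
  "fits (slot3 1) {#4, 3 * q + 5#} 0"
proof (rule fitsI)
  show "cyclic_chain (slot3 1) c" if "c \<in> set [[0, 2, 3, 4], 1 # [5..<3 * q + 9]]" for c
    using that by (auto simp: chain_simps simp del: upt_Suc; simp add: slot3_def; presburger)
qed (auto, simp add: eval_nat_numeral)

lemma fits_4_residue_1:
  "fits (slot3 1) {#4, 3 * q + 7#} 0"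
proof (rule fitsI)
  show "cyclic_chain (slot3 1) c"
    if "c \<in> set [[0, 2, 3, 4], [1, 5] @ [9..<3 * q + 11] @ [6, 7, 8]]" for c
    using that by (auto simp: chain_simps simp del: upt_Suc; simp add: slot3_def; presburger)
qed (auto, simp add: eval_nat_numeral)

lemma fits_4_4_4: "fits (slot3 1) {#4, 4, 4#} 0"
proof (rule fitsI)
  show "cyclic_chain (slot3 1) c" if "c \<in> set [[0, 2, 3, 4], [1, 5, 9, 8], [6, 7, 11, 10]]" for c
    using that by (auto simp: chain_simps slot3_def)
  show "set (concat [[0, 2, 3, 4], [1, 5, 9, 8], [6, 7, 11, 10]]) =
      {0..<0 + sum_mset {#4, 4, 4::nat#}}"
  proof (intro equalityI subsetI)
    fix x assume "x \<in> {0..<0 + sum_mset {#4, 4, 4::nat#}}"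
    then have "x < 12" by simp
    then show "x \<in> set (concat [[0, 2, 3, 4], [1, 5, 9, 8], [6, 7, 11, 10]])"
      by simp presburger
  qed auto
qed (simp_all add: numeral_eq_Suc)

section \<open>Decomposition into cycles\<close>

text \<open>A 2-regular simple graph on \<open>X\<close>, given by its adjacency relation. It is
  applied to the line graph: \<open>X\<close> is the set of edges and \<open>R\<close> is
  \<open>adjacent\<close>.\<close>

definition two_neighbours :: "('a \<Rightarrow> 'a \<Rightarrow> bool) \<Rightarrow> 'a set \<Rightarrow> bool" where
  "two_neighbours R X \<longleftrightarrow> (\<forall>x\<in>X. \<forall>y\<in>X. R x y \<longrightarrow> R y x) \<and> (\<forall>x\<in>X. \<not> R x x) \<and>
     (\<forall>x\<in>X. card {y \<in> X. R x y} = 2)"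

definition consecutive :: "'a list \<Rightarrow> 'a \<Rightarrow> 'a \<Rightarrow> bool" where
  "consecutive c x y \<longleftrightarrow> (\<exists>i<length c. x = c ! i \<and> y = c ! (Suc i mod length c))"

lemma card_2_eqI:
  assumes "card A = 2" "{a, b} \<subseteq> A" "a \<noteq> b"
  shows "A = {a, b}"
proof -
  have "finite A" using assms(1) by (intro card_ge_0_finite) auto
  then show ?thesis using card_subset_eq[of A "{a, b}"] assms by auto
qed

text \<open>A longest path closes up: both neighbours of its last vertex lie on it, and an interior
  vertex has no room for a third neighbour.\<close>

lemma cycle_exists:
  assumes fin: "finite X" and ne: "X \<noteq> {}" and R: "two_neighbours R X"
  obtains c where "distinct c" "set c \<subseteq> X" "length c \<ge> 3"
    "\<And>i. i < length c \<Longrightarrow> R (c ! i) (c ! (Suc i mod length c))"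
    "\<And>i. i < length c \<Longrightarrow>
       {y \<in> X. R (c ! i) y} = {c ! (Suc i mod length c), c ! ((i + length c - 1) mod length c)}"
proof -
  have sym: "R y x" if "R x y" "x \<in> X" "y \<in> X" for x y
    using R that unfolding two_neighbours_def by blast
  have irr: "\<not> R x x" if "x \<in> X" for x
    using R that unfolding two_neighbours_def by blast
  have two: "card {y \<in> X. R x y} = 2" if "x \<in> X" for x
    using R that unfolding two_neighbours_def by blast
  define paths where "paths = {xs. distinct xs \<and> set xs \<subseteq> X \<and> successively R xs \<and> xs \<noteq> []}"
  obtain x0 where "x0 \<in> X" using ne by blast
  then have p0: "[x0] \<in> paths" unfolding paths_def by simp
  have "length xs < Suc (card X)" if "xs \<in> paths" for xs
    using that fin card_mono[of X "set xs"] distinct_card[of xs] unfolding paths_def by auto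
  then obtain c where c: "c \<in> paths" and max: "\<And>xs. xs \<in> paths \<Longrightarrow> length xs \<le> length c"
    using ex_has_greatest_nat[of "\<lambda>xs. xs \<in> paths" "[x0]" length "Suc (card X)"] p0 by blast
  define m where "m = length c"
  have cd: "distinct c" "set c \<subseteq> X" "successively R c" "m > 0"
    using c unfolding paths_def m_def by auto
  have inX: "c ! i \<in> X" if "i < m" for i using cd that unfolding m_def by auto
  have step: "R (c ! i) (c ! Suc i)" if "Suc i < m" for i
    using cd(3) that unfolding m_def by (simp add: successively_conv_nth)
  have nth_eq: "c ! i = c ! j \<longleftrightarrow> i = j" if "i < m" "j < m" for i j
    using cd(1) that unfolding m_def by (simp add: nth_eq_iff_index_eq)
  have nb: "y \<in> set c" if "y \<in> X" "R (c ! (m - 1)) y" for y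
  proof (rule ccontr)
    assume "y \<notin> set c"
    then have "c @ [y] \<in> paths"
      using cd that unfolding paths_def m_def
      by (auto simp: successively_append_iff last_conv_nth)
    from max[OF this] show False by simp
  qed
  obtain u v where uv: "{y \<in> X. R (c ! (m - 1)) y} = {u, v}" "u \<noteq> v"
    using two[OF inX[of "m - 1"]] cd(4) by (auto simp: card_2_iff)
  then have "u \<in> set c" "v \<in> set c" using nb by auto
  then obtain i j where ij: "i < m" "j < m" "c ! i = u" "c ! j = v"
    unfolding m_def by (metis in_set_conv_nth)
  have "i \<noteq> m - 1" "j \<noteq> m - 1" "i \<noteq> j"
    using uv ij irr by auto
  \<comment> \<open>At most one of the two neighbours is the predecessor \<open>c ! (m - 2)\<close>;
    the other lies further back.\<close>
  then obtain k where k: "k < m - 2" "R (c ! (m - 1)) (c ! k)"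
  proof (cases "i < m - 2")
    case True
    then show ?thesis using that[of i] uv ij by auto
  next
    case False
    then have "j < m - 2" using \<open>i \<noteq> m - 1\<close> \<open>j \<noteq> m - 1\<close> \<open>i \<noteq> j\<close> ij by linarith
    then show ?thesis using that[of j] uv ij by auto
  qed
  have "k = 0"
  proof (rule ccontr)
    assume "k \<noteq> 0"
    have "{c ! (k - 1), c ! Suc k} \<subseteq> {y \<in> X. R (c ! k) y}"
      using step[of "k - 1"] step[of k] sym[of "c ! (k - 1)" "c ! k"] inX \<open>k \<noteq> 0\<close> k(1) by auto
    moreover have "c ! (k - 1) \<noteq> c ! Suc k"
      using nth_eq[of "k - 1" "Suc k"] k(1) by auto
    ultimately have "{y \<in> X. R (c ! k) y} = {c ! (k - 1), c ! Suc k}"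
      using two[OF inX[of k]] k(1) by (intro card_2_eqI) auto
    moreover have "c ! (m - 1) \<in> {y \<in> X. R (c ! k) y}"
      using k sym inX by auto
    ultimately show False
      using nth_eq[of "m - 1" "k - 1"] nth_eq[of "m - 1" "Suc k"] k(1) by auto
  qed
  with k have m3: "m \<ge> 3" and close: "R (c ! (m - 1)) (c ! 0)" by auto
  have cyc: "R (c ! i) (c ! (Suc i mod m))" if "i < m" for i
  proof (cases "Suc i = m")
    case True
    then show ?thesis using close by (metis diff_Suc_1 mod_self)
  next
    case False
    then show ?thesis using step[of i] that by simp
  qed
  have nbs: "{y \<in> X. R (c ! i) y} = {c ! (Suc i mod m), c ! ((i + m - 1) mod m)}" if i: "i < m" for i
  proof (rule card_2_eqI)
    show "card {y \<in> X. R (c ! i) y} = 2" using two inX i by blast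
    have e: "Suc ((i + m - 1) mod m) mod m = i"
      using mod_Suc_eq[of "i + m - 1" m] i by simp
    have "R (c ! ((i + m - 1) mod m)) (c ! i)"
      using cyc[of "(i + m - 1) mod m"] i unfolding e by simp
    then show "{c ! (Suc i mod m), c ! ((i + m - 1) mod m)} \<subseteq> {y \<in> X. R (c ! i) y}"
      using cyc[OF i] inX i sym by auto
    have "Suc i mod m \<noteq> (i + m - 1) mod m"
    proof (cases "i = 0")
      case True
      then show ?thesis using m3 by simp
    next
      case False
      then have "(i + m - 1) mod m = (i - 1 + m) mod m"
        by (simp add: add.commute)
      then have "(i + m - 1) mod m = i - 1"
        using i by simp
      then show ?thesis using False i m3 by (cases "Suc i = m") auto
    qed
    then show "c ! (Suc i mod m) \<noteq> c ! ((i + m - 1) mod m)"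
      using nth_eq i by simp
  qed
  show ?thesis
    using cd(1,2) m3 cyc nbs unfolding m_def by (rule that)
qed

text \<open>Both neighbours of every element of a cycle lie on it, so removing the cycle leaves the
  other elements their two neighbours, and induction applies. Through the last clause, bounds along
  the cycles cover all related pairs.\<close>

lemma cycle_decomposition:
  assumes "finite X" "two_neighbours R X"
  shows "\<exists>cs. distinct (concat cs) \<and> set (concat cs) = X \<and>
    (\<forall>c\<in>set cs. length c \<ge> 3 \<and> (\<forall>i<length c. R (c ! i) (c ! (Suc i mod length c)))) \<and>
    (\<forall>x\<in>X. \<forall>y\<in>X. R x y \<longrightarrow> (\<exists>c\<in>set cs. consecutive c x y \<or> consecutive c y x))"
  using assms
proof (induction "card X" arbitrary: X rule: less_induct)
  case less
  show ?case
  proof (cases "X = {}")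
    case True
    then show ?thesis by (intro exI[of _ "[]"]) auto
  next
    case False
    obtain c where c: "distinct c" "set c \<subseteq> X" "length c \<ge> 3"
      and step: "\<And>i. i < length c \<Longrightarrow> R (c ! i) (c ! (Suc i mod length c))"
      and nbs: "\<And>i. i < length c \<Longrightarrow> {y \<in> X. R (c ! i) y} =
        {c ! (Suc i mod length c), c ! ((i + length c - 1) mod length c)}"
      by (rule cycle_exists[OF less.prems(1) False less.prems(2)]) (rule that; assumption)
    have pos: "length c > 0" using c(3) by linarith
    have sym: "R y x" if "R x y" "x \<in> X" "y \<in> X" for x y
      using less.prems(2) that unfolding two_neighbours_def by blast
    have near: "consecutive c x y \<or> consecutive c y x" if xy: "x \<in> set c" "y \<in> X" "R x y" for x y
    proof -
      obtain i where i: "i < length c" "x = c ! i" using xy(1) by (auto simp: in_set_conv_nth)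
      \<comment> \<open>The index of the predecessor; \<open>length c\<close> is added before
        subtracting so that \<open>i = 0\<close> wraps round to the last index.\<close>
      define j where "j = (i + length c - 1) mod length c"
      have j: "j < length c" "Suc j mod length c = i"
        using mod_Suc_eq[of "i + length c - 1" "length c"] i(1) pos unfolding j_def by auto
      have "y = c ! (Suc i mod length c) \<or> y = c ! j"
        using nbs[OF i(1)] xy i(2) unfolding j_def by blast
      then show ?thesis
        using i j unfolding consecutive_def by auto
    qed
    have on_cycle: "y \<in> set c" if "x \<in> set c" "y \<in> X" "R x y" for x y
      using near[OF that] pos unfolding consecutive_def by auto
    define Y where "Y = X - set c"
    have "{y \<in> Y. R x y} = {y \<in> X. R x y}" if "x \<in> Y" for x
      using that on_cycle sym c(2) unfolding Y_def by blast
    then have "two_neighbours R Y"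
      using less.prems(2) unfolding two_neighbours_def by (auto simp: Y_def)
    moreover have "card Y < card X"
      using c(2) nth_mem[OF pos] less.prems(1) unfolding Y_def
      by (intro psubset_card_mono) blast+
    ultimately obtain cs where cs: "distinct (concat cs)" "set (concat cs) = Y"
      "\<forall>c\<in>set cs. length c \<ge> 3 \<and> (\<forall>i<length c. R (c ! i) (c ! (Suc i mod length c)))"
      "\<forall>x\<in>Y. \<forall>y\<in>Y. R x y \<longrightarrow> (\<exists>c\<in>set cs. consecutive c x y \<or> consecutive c y x)"
      using less.hyps[of Y] less.prems(1) unfolding Y_def by blast
    have "\<exists>d\<in>set (c # cs). consecutive d x y \<or> consecutive d y x"
      if "x \<in> X" "y \<in> X" "R x y" for x y
    proof (cases "x \<in> set c \<or> y \<in> set c")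
      case True
      then show ?thesis using near sym that by (meson list.set_intros(1))
    next
      case False
      then show ?thesis using cs(4) that unfolding Y_def by auto
    qed
    moreover have "distinct (concat (c # cs))" "set (concat (c # cs)) = X"
      using c cs(1,2) unfolding Y_def by auto
    moreover have "\<forall>d\<in>set (c # cs). length d \<ge> 3 \<and>
        (\<forall>i<length d. R (d ! i) (d ! (Suc i mod length d)))"
      using c(3) step cs(3) by simp
    ultimately show ?thesis by blast
  qed
qed

section \<open>Packing all cycles of a graph\<close>

text \<open>The two families of patterns start at 5 for residue 2 and at 7 for residue 1, which
  leaves out the length 4.\<close>

lemma fits_single:
  assumes "x \<ge> 5" "x mod 3 \<noteq> 0"
  shows "fits (slot3 k) {#x#} a"
proof -
  have "x = 3 * (x div 3 - 2) + 7 \<or> x = 3 * (x div 3 - 1) + 5"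
    using assms by presburger
  then have "fits (slot3 0) {#x#} 0"
    using fits_residue_1 fits_residue_2 by metis
  then show ?thesis
    by (rule fits_translate) (rule slot3_0_add)
qed

text \<open>Only patterns for \<open>slot3 0\<close> are used, which fit at any start and for any
  \<open>k\<close>. Taking 4-cycles two at a time keeps their number even.\<close>

lemma fits_even_fours:
  assumes "\<And>x. x \<in># M \<Longrightarrow> x \<ge> 4 \<and> x mod 3 \<noteq> 0" "even (count M 4)"
  shows "fits (slot3 k) M a"
  using assms
proof (induction "size M" arbitrary: M a rule: less_induct)
  case (less M a)
  consider "M = {#}" | x where "x \<in># M" "x \<noteq> 4" | "4 \<in># M" by fastforce
  then show ?case
  proof cases
    case 1
    then show ?thesis by (simp add: fits_empty)
  next
    case 2
    then obtain N where N: "M = {#x#} + N"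
      by (metis add_mset_add_single insert_DiffM union_commute)
    have "fits (slot3 k) {#x#} a"
      using less.prems(1)[of x] 2 by (intro fits_single) auto
    moreover have "fits (slot3 k) N (a + sum_mset {#x#})"
      using less.prems 2(2) unfolding N by (intro less.hyps) (auto simp: N)
    ultimately show ?thesis
      unfolding N by (rule fits_add)
  next
    case 3
    then have "count M 4 \<ge> 2"
      using less.prems(2) by (metis One_nat_def Suc_leI count_greater_zero_iff le_neq_implies_less
          numeral_2_eq_2 odd_one)
    then have "{#4, 4#} \<subseteq># M"
      by (auto simp: subseteq_mset_def)
    then obtain N where N: "M = {#4, 4#} + N"
      using subset_mset.le_iff_add by metis
    have "fits (slot3 k) {#4, 4#} a"
      using fits_4_4 by (rule fits_translate) (rule slot3_0_add)
    moreover have "fits (slot3 k) N (a + sum_mset {#4, 4#})"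
      using less.prems unfolding N by (intro less.hyps) (auto simp: N)
    ultimately show ?thesis
      unfolding N by (rule fits_add)
  qed
qed

text \<open>Every block has length divisible by three, so the next one again starts at residue 0,
  from where a step by two is allowed.\<close>

lemma fits_dvd_3:
  assumes "\<And>x. x \<in># M \<Longrightarrow> x \<ge> 3 \<and> 3 dvd x" "3 dvd a" "k \<ge> 1"
  shows "fits (slot3 k) M a"
  using assms(1,2)
proof (induction M arbitrary: a)
  case empty
  then show ?case by (simp add: fits_empty)
next
  case (add x M)
  have "x = 3 * (x div 3 - 1) + 3"
    using add.prems(1)[of x] by auto
  then have "fits (slot3 1) {#x#} 0"
    using fits_residue_0 by metis
  then have "fits (slot3 k) {#x#} a"
    by (rule fits_translate) (rule slot3_add[OF _ assms(3) add.prems(2)])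
  moreover have "fits (slot3 k) M (a + sum_mset {#x#})"
    using add.prems by (intro add.IH) auto
  ultimately have "fits (slot3 k) ({#x#} + M) a"
    by (rule fits_add)
  then show ?case by simp
qed

lemma dvd_sum_msetI: "(\<And>x. x \<in># M \<Longrightarrow> d dvd x) \<Longrightarrow> d dvd sum_mset M"
  for d :: nat
  by (induction M) auto

text \<open>Even numbers of 4-cycles are packed in pairs. An odd one out is absorbed by another cycle,
  or needs the extra room available when the total length is not divisible by three.\<close>

lemma fits_slot3:
  assumes "\<And>x. x \<in># M \<Longrightarrow> x \<ge> 3"
  shows "fits (slot3 (Suc (sum_mset M mod 3))) M 0"
proof -
  define r where "r = sum_mset M mod 3"
  define D where "D = filter_mset (\<lambda>x. 3 dvd x) M"
  define N where "N = filter_mset (\<lambda>x. \<not> 3 dvd x) M"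
  have M: "M = D + N"
    unfolding D_def N_def by (rule multiset_partition)
  define a where "a = sum_mset D"
  have a: "3 dvd a"
    unfolding a_def D_def by (intro dvd_sum_msetI) auto
  have D: "fits (slot3 (Suc r)) D 0"
    using assms by (intro fits_dvd_3) (auto simp: D_def)
  have N: "x \<ge> 4 \<and> x mod 3 \<noteq> 0" if "x \<in># N" for x
    using that assms[of x] by (cases "x = 3") (auto simp: N_def mod_eq_0_iff_dvd)
  \<comment> \<open>A pattern \<open>L\<close> absorbing the odd 4-cycle goes first, at the multiple
    of three \<open>a\<close>; the rest \<open>K\<close> has an even number of 4-cycles.\<close>
  have place: "fits (slot3 (Suc r)) N a"
    if L: "fits (slot3 j) L 0" "j \<le> Suc r" and K: "L + K = N" "even (count K 4)" for j L K
    unfolding K(1)[symmetric]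
  proof (rule fits_add)
    show "fits (slot3 (Suc r)) L a"
      using L(1) by (rule fits_translate) (rule slot3_add[OF _ L(2) a])
    show "fits (slot3 (Suc r)) K (a + sum_mset L)"
      using N K by (intro fits_even_fours) auto
  qed
  have "fits (slot3 (Suc r)) N a"
  proof (cases "even (count N 4)")
    case True
    then show ?thesis
      using N by (intro fits_even_fours) auto
  next
    case False
    then have "4 \<in># N"
      by (metis count_greater_zero_iff even_zero not_gr_zero)
    then obtain K where K: "N = {#4#} + K"
      by (metis add_mset_add_single insert_DiffM union_commute)
    then have even: "even (count K 4)"
      using False by simp
    have r: "r = sum_mset N mod 3"
      using a unfolding r_def M a_def by (auto elim!: dvdE)
    \<comment> \<open>For \<open>r \<ge> 1\<close> the parameter is at least 2 and the odd 4-cycle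
      fits alone. For \<open>r = 0\<close> it needs company: some other cycle, or else two further
      4-cycles.\<close>
    consider "r \<ge> 1" | "r = 0" "\<exists>x. x \<in># K \<and> x \<noteq> 4" | "r = 0" "\<forall>x. x \<in># K \<longrightarrow> x = 4"
      by fastforce
    then show ?thesis
    proof cases
      case 1
      then show ?thesis
        using place[OF fits_4 _ K[symmetric] even] by simp
    next
      case 2
      then obtain x L where x: "x \<noteq> 4" "K = {#x#} + L"
        by (metis add_mset_add_single insert_DiffM union_commute)
      have "x \<ge> 5" "x mod 3 \<noteq> 0"
        using N[of x] x K by auto
      then have "x = 3 * (x div 3 - 2) + 7 \<or> x = 3 * (x div 3 - 1) + 5"
        by presburger
      then have "fits (slot3 1) {#4, x#} 0"
        using fits_4_residue_1 fits_4_residue_2 by metis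
      then show ?thesis
        using place[of 1 "{#4, x#}" L] even K x by (simp add: add_mset_commute)
    next
      case 3
      then have rep: "K = replicate_mset (size K) 4"
        by (metis set_mset_subset_singletonD singletonI subsetI)
      then have "sum_mset K = size K * 4"
        by (metis sum_mset_replicate_mset of_nat_id)
      \<comment> \<open>A lone 4-cycle would have total length 4, not divisible by three; as
        \<open>size K\<close> is even, it is at least 2.\<close>
      then have "(4 + size K * 4) mod 3 = 0"
        using r 3(1) unfolding K by simp
      then have "size K \<noteq> 0" by (cases "size K = 0") auto
      moreover have "even (size K)"
        using even rep by (metis count_replicate_mset)
      ultimately have "size K \<ge> 2" by presburger
      then have "count K 4 \<ge> 2"
        using rep by (metis count_replicate_mset)
      then have "{#4, 4#} \<subseteq># K"
        by (auto simp: subseteq_mset_def)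
      then obtain L where "K = {#4, 4#} + L"
        using subset_mset.le_iff_add by metis
      then show ?thesis
        using place[OF fits_4_4_4, of L] even K by (simp add: add_mset_commute)
    qed
  qed
  then show ?thesis
    using fits_add[OF D] unfolding M[symmetric] a_def r_def by (simp add: M)
qed

text \<open>Slot \<open>s\<close> lies in the half number \<open>s mod 2\<close>, at level \<open>s div 2\<close>: allowed pairs lie in different
  halves and their levels differ by at most one.\<close>

definition slot2 :: "nat \<Rightarrow> nat \<Rightarrow> bool" where
  "slot2 x y \<longleftrightarrow> y = x + 1 \<or> x = y + 1 \<or> even x \<and> y = x + 3 \<or> even y \<and> x = y + 3"

text \<open>The edge between the last two slots of the cycle is opened to insert two more slots.\<close>

lemma slot2_chain:
  "\<exists>xs. distinct xs \<and> set xs = {0..<2 * k + 2} \<and> successively slot2 xs \<and> xs \<noteq> [] \<and>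
     hd xs = 2 * k + 1 \<and> last xs = 2 * k"
proof (induction k)
  case 0
  show ?case
    by (rule exI[of _ "[1, 0]"]) (auto simp: slot2_def)
next
  case (Suc k)
  then obtain xs where xs: "distinct xs" "set xs = {0..<2 * k + 2}" "successively slot2 xs"
    "xs \<noteq> []" "hd xs = 2 * k + 1" "last xs = 2 * k"
    by blast
  have sym: "(\<lambda>x y. slot2 y x) = slot2"
    by (auto simp: slot2_def fun_eq_iff)
  \<comment> \<open>Reversal puts \<open>2 * k\<close> first, next to \<open>2 * k + 3\<close>, and
    \<open>2 * k + 1\<close> last, next to \<open>2 * k + 2\<close>; the new ends are again the two
    largest slots.\<close>
  let ?ys = "(2 * k + 3) # rev xs @ [2 * k + 2]"
  have "successively slot2 (rev xs)"
    using xs(3) unfolding successively_rev sym .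
  moreover have "slot2 (2 * k + 3) (2 * k)" "slot2 (2 * k + 1) (2 * k + 2)"
    by (auto simp: slot2_def)
  ultimately have "successively slot2 ?ys"
    using xs(4-6) by (auto simp: successively_Cons successively_append_iff hd_append hd_rev
        last_rev)
  moreover have "set ?ys = {0..<2 * Suc k + 2}"
    using xs(2) by auto
  moreover have "distinct ?ys"
    using xs(1,2) by auto
  ultimately show ?case
    by (intro exI[of _ ?ys]) auto
qed

text \<open>Even shifts preserve \<open>slot2\<close>, and as all lengths are even, every block
  starts at an even slot.\<close>

lemma fits_slot2:
  assumes "\<And>x. x \<in># M \<Longrightarrow> even x \<and> x > 0" "even a"
  shows "fits slot2 M a"
  using assms
proof (induction M arbitrary: a)
  case empty
  then show ?case by (simp add: fits_empty)
next
  case (add x M)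
  have x: "x = 2 * (x div 2 - 1) + 2"
    using add.prems(1)[of x] by auto
  then obtain xs where xs: "distinct xs" "set xs = {0..<x}" "successively slot2 xs" "xs \<noteq> []"
    "hd xs = 2 * (x div 2 - 1) + 1" "last xs = 2 * (x div 2 - 1)"
    using slot2_chain[of "x div 2 - 1"] by metis
  have "slot2 (last xs) (hd xs)"
    unfolding xs(5,6) slot2_def by simp
  moreover have "length xs = x"
    using distinct_card[OF xs(1)] xs(2) by simp
  ultimately have "fits slot2 {#x#} 0"
    using xs by (intro fitsI[of "[xs]"]) (auto simp: cyclic_chain_def)
  then have "fits slot2 {#x#} a"
    by (rule fits_translate) (use add.prems(2) in \<open>auto simp: slot2_def\<close>)
  moreover have "fits slot2 M (a + sum_mset {#x#})"
    using add.prems by (intro add.IH) auto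
  ultimately have "fits slot2 ({#x#} + M) a"
    by (rule fits_add)
  then show ?case by simp
qed

section \<open>From packings to slots of edges\<close>

lemma reorder_mset_map:
  assumes "mset (map g ss) = mset (map h cs)"
  shows "\<exists>ts. mset ts = mset ss \<and> map g ts = map h cs"
  using assms
proof (induction cs arbitrary: ss)
  case Nil
  then show ?case by simp
next
  case (Cons c cs)
  then have "h c \<in> set (map g ss)"
    by (metis list.set_intros(1) list.simps(9) mset_eq_setD)
  then obtain s where s: "s \<in> set ss" "g s = h c" by auto
  have ss: "mset ss = add_mset s (mset (remove1 s ss))"
    using s(1) by simp
  then have "mset (map g (remove1 s ss)) = mset (map h cs)"
    using Cons.prems s(2) arg_cong[OF ss, of "image_mset g"] by (simp del: mset_remove1)
  then obtain ts where "mset ts = mset (remove1 s ss)" "map g ts = map h cs"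
    using Cons.IH by blast
  then show ?case
    using s by (intro exI[of _ "s # ts"]) simp
qed

lemma distinct_map_exists:
  assumes "distinct xs" "length xs = length ys"
  shows "\<exists>f. map f xs = ys"
  using assms
  by (intro exI[of _ "the \<circ> map_of (zip xs ys)"] nth_equalityI) (simp_all add: map_of_zip_nth)

text \<open>Reordering matches each cycle with a slot list of its length
  (\<open>reorder_mset_map\<close>). As the lengths agree, a function carrying the concatenated
  cycles to the concatenated slot lists carries each cycle onto its own list.\<close>

lemma fits_assignment:
  assumes "fits P (mset (map length cs)) 0" "distinct (concat cs)"
  obtains f where "bij_betw f (set (concat cs)) {..<card (set (concat cs))}"
    "\<And>c x y. c \<in> set cs \<Longrightarrow> consecutive c x y \<Longrightarrow> P (f x) (f y)"
proof -
  have card: "sum_mset (mset (map length cs)) = card (set (concat cs))"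
    using distinct_card[OF assms(2)] by (simp add: length_concat flip: sum_mset_sum_list)
  obtain ss where ss: "mset (map length ss) = mset (map length cs)"
    "mset (concat ss) = mset [0..<card (set (concat cs))]" "\<forall>c\<in>set ss. cyclic_chain P c"
    using assms(1) unfolding fits_def card by auto
  obtain ts where ts: "mset ts = mset ss" "map length ts = map length cs"
    using reorder_mset_map[OF ss(1)] by blast
  have "mset (concat ts) = mset (concat ss)"
    using ts(1) by (metis mset_concat mset_map sum_mset_sum_list)
  then have cts: "mset (concat ts) = mset [0..<card (set (concat cs))]"
    using ss(2) by simp
  have "length (concat cs) = length (concat ts)"
    using ts(2) by (simp add: length_concat)
  then obtain f where f: "map f (concat cs) = concat ts"
    using distinct_map_exists assms(2) by blast
  have mf: "map (map f) cs = ts"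
  proof (rule concat_injective)
    show "concat (map (map f) cs) = concat ts"
      using f by (simp add: map_concat)
    show "length (map (map f) cs) = length ts"
      using ts(2) by (metis length_map)
    show "\<forall>(x, y)\<in>set (zip (map (map f) cs) ts). length x = length y"
      using ts(2) by (auto simp: set_zip) (metis length_map nth_map)
  qed
  have "distinct (concat ts)" "set (concat ts) = {..<card (set (concat cs))}"
    using mset_eq_imp_distinct_iff[OF cts] mset_eq_setD[OF cts] by auto
  then have "bij_betw f (set (concat cs)) {..<card (set (concat cs))}"
    unfolding bij_betw_def f[symmetric] distinct_map set_map by blast
  moreover have "P (f x) (f y)" if xy: "c \<in> set cs" "consecutive c x y" for c x y
  proof -
    obtain i where i: "i < length c" "x = c ! i" "y = c ! (Suc i mod length c)"
      using xy(2) unfolding consecutive_def by blast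
    have "map f c \<in> set ts"
      using xy(1) mf by auto
    then have "cyclic_chain P (map f c)"
      using ss(3) ts(1) mset_eq_setD by blast
    moreover have "Suc i mod length c < length c"
      using i(1) by (intro mod_less_divisor) linarith
    ultimately show ?thesis
      using cyclic_chain_nth[of P "map f c" i] i by simp
  qed
  ultimately show thesis by (rule that)
qed

section \<open>Cyclic distances\<close>

lemma forward_dist_eq:
  assumes "l e < card E" "l e' < card E" "l e \<noteq> l e'"
  shows "forward_dist E l e e' = (if l e < l e' then l e' - l e else card E + l e' - l e)"
  unfolding forward_dist_def
proof (rule Least_equality)
  let ?d = "if l e < l e' then l e' - l e else card E + l e' - l e"
  show "?d > 0 \<and> [l e + ?d = l e'] (mod card E)"
    using assms by (auto simp: cong_def)
  fix d assume "d > 0 \<and> [l e + d = l e'] (mod card E)"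
  then have eq: "(l e + d) mod card E = l e'"
    using assms by (simp add: cong_def)
  show "?d \<le> d"
  proof (cases "l e + d < card E")
    case True
    then show ?thesis using eq assms(3) by auto
  next
    case False
    moreover have "(l e + d) mod card E = (l e + d - card E) mod card E"
      using False by (simp add: le_mod_geq)
    then have "l e' \<le> l e + d - card E"
      using eq by (metis mod_less_eq_dividend)
    ultimately show ?thesis using assms by auto
  qed
qed

lemma is_orderingD:
  assumes "is_ordering E l"
  shows "e \<in> E \<Longrightarrow> l e < card E" "e \<in> E \<Longrightarrow> e' \<in> E \<Longrightarrow> l e = l e' \<longleftrightarrow> e = e'"
  using assms unfolding is_ordering_def bij_betw_def inj_on_def by auto

text \<open>The forward and the backward arc must both have length at least \<open>s\<close>; the
  additive form avoids truncated subtraction and leaves linear inequalities.\<close>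

lemma le_cyclic_dist_iff:
  assumes "is_ordering E l" "e \<in> E" "e' \<in> E" "e \<noteq> e'"
  shows "s \<le> cyclic_dist E l e e' \<longleftrightarrow>
    (l e + s \<le> l e' \<and> l e' + s \<le> card E + l e) \<or>
    (l e' + s \<le> l e \<and> l e + s \<le> card E + l e') \<or> s = 0"
proof -
  have l: "l e < card E" "l e' < card E" "l e \<noteq> l e'"
    using is_orderingD[OF assms(1)] assms by auto
  then have "forward_dist E l e e' = (if l e < l e' then l e' - l e else card E + l e' - l e)"
    "forward_dist E l e' e = (if l e' < l e then l e - l e' else card E + l e - l e')"
    using forward_dist_eq[of l e E e'] forward_dist_eq[of l e' E e] by auto
  then show ?thesis
    using l unfolding cyclic_dist_def min.bounded_iff
    by (simp split: if_split) linarith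
qed

definition separated :: "'a set set \<Rightarrow> ('a set \<Rightarrow> nat) \<Rightarrow> nat \<Rightarrow> bool" where
  "separated E l s \<longleftrightarrow> (\<forall>e\<in>E. \<forall>e'\<in>E. adjacent e e' \<longrightarrow> s \<le> cyclic_dist E l e e')"

text \<open>Distinct edges have distinct places. This makes the maximum in
  \<open>cms_ordering\<close> range over a nonempty set.\<close>

lemma separated_1:
  assumes "is_ordering E l" shows "separated E l 1"
  unfolding separated_def
proof (intro ballI impI)
  fix e e' assume e: "e \<in> E" "e' \<in> E" "adjacent e e'"
  then have "e \<noteq> e'" unfolding adjacent_def by simp
  moreover from this have "l e < card E" "l e' < card E" "l e \<noteq> l e'"
    using is_orderingD[OF assms] e by auto
  ultimately show "1 \<le> cyclic_dist E l e e'"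
    using le_cyclic_dist_iff[OF assms e(1,2)] by auto
qed

lemma cms_ordering_mem:
  assumes "is_ordering E l" "finite E" "E \<noteq> {}"
  shows "cms_ordering E l \<in> {1..card E} \<and> separated E l (cms_ordering E l)"
proof -
  have "card E \<ge> 1"
    using assms(2,3) by (simp add: Suc_le_eq card_gt_0_iff)
  then have "{s \<in> {1..card E}. separated E l s} \<noteq> {}"
    using separated_1[OF assms(1)] by auto
  moreover have "cms_ordering E l = Max {s \<in> {1..card E}. separated E l s}"
    unfolding cms_ordering_def separated_def ..
  ultimately show ?thesis
    using Max_in[of "{s \<in> {1..card E}. separated E l s}"] by auto
qed

lemma finite_cms_orderings:
  assumes "finite E" "E \<noteq> {}"
  shows "finite {cms_ordering E l | l. is_ordering E l}"
proof (rule finite_subset)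
  show "{cms_ordering E l | l. is_ordering E l} \<subseteq> {1..card E}"
    using cms_ordering_mem assms by blast
qed simp

lemma cms_graph_geI:
  assumes "finite E" "is_ordering E l" "separated E l s" "1 \<le> s" "s \<le> card E"
  shows "s \<le> cms_graph E"
proof -
  have "E \<noteq> {}" using assms(4,5) by auto
  have "s \<le> cms_ordering E l"
    using assms(3-5) unfolding cms_ordering_def separated_def by (intro Max_ge) auto
  also have "\<dots> \<le> cms_graph E"
    unfolding cms_graph_def
    using finite_cms_orderings[OF assms(1) \<open>E \<noteq> {}\<close>] assms(2) by (intro Max_ge) auto
  finally show ?thesis .
qed

lemma cms_graph_leI:
  assumes "finite E" "E \<noteq> {}" "\<And>l s. is_ordering E l \<Longrightarrow> separated E l s \<Longrightarrow> s \<le> b"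
  shows "cms_graph E \<le> b"
proof -
  have "\<exists>l. is_ordering E l"
    using ex_bij_betw_finite_nat[OF assms(1)] unfolding is_ordering_def atLeast0LessThan .
  then have "cms_graph E \<in> {cms_ordering E l | l. is_ordering E l}"
    unfolding cms_graph_def by (intro Max_in finite_cms_orderings assms) blast
  then obtain l where "is_ordering E l" "cms_graph E = cms_ordering E l"
    by blast
  then show ?thesis
    using cms_ordering_mem[OF _ assms(1,2)] assms(3) by auto
qed

section \<open>2-regular graphs and their line graphs\<close>

lemma regular_2_graphD:
  assumes "regular_graph 2 V E"
  shows "finite V" "finite E" "e \<in> E \<Longrightarrow> e \<subseteq> V" "e \<in> E \<Longrightarrow> card e = 2"
    "v \<in> V \<Longrightarrow> card {e \<in> E. v \<in> e} = 2"
proof -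
  have "E \<subseteq> Pow V" "finite V"
    using assms unfolding regular_graph_def simple_graph_def by auto
  then show "finite V" "finite E"
    by (auto intro: finite_subset)
qed (use assms in \<open>auto simp: regular_graph_def simple_graph_def degree_def\<close>)

text \<open>Incident pairs of a vertex and an edge are counted in two ways. Hence an ordering has as
  many places as there are vertices.\<close>

lemma regular_2_card:
  assumes "regular_graph 2 V E"
  shows "card E = card V"
proof -
  note G = regular_2_graphD[OF assms]
  have "2 * card V = (\<Sum>v\<in>V. \<Sum>e\<in>E. if v \<in> e then 1 else 0)"
    using G(2,5) by (simp add: sum.If_cases Int_def)
  also have "\<dots> = (\<Sum>e\<in>E. \<Sum>v\<in>V. if v \<in> e then 1 else 0)"
    by (rule sum.swap)
  also have "\<dots> = (\<Sum>e\<in>E. card e)"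
    using G(1,3) by (intro sum.cong refl) (simp add: sum.If_cases Int_absorb1)
  also have "\<dots> = 2 * card E"
    using G(4) by simp
  finally show ?thesis by simp
qed

text \<open>Each end of an edge \<open>e\<close> carries exactly one further edge, and these two
  differ, since an edge through both ends would be \<open>e\<close> itself.\<close>

lemma regular_2_two_neighbours:
  assumes "regular_graph 2 V E"
  shows "two_neighbours adjacent E"
  unfolding two_neighbours_def
proof (intro conjI ballI)
  note G = regular_2_graphD[OF assms]
  fix e assume e: "e \<in> E"
  then obtain u v where uv: "e = {u, v}" "u \<noteq> v"
    using G(4)[OF e] unfolding card_2_iff by blast
  have other: "\<exists>f. f \<noteq> e \<and> {g \<in> E. w \<in> g} = {e, f}" if w: "w \<in> e" for w
  proof -
    have "card {g \<in> E. w \<in> g} = 2"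
      using G(3,5) w e by blast
    then obtain g h where "{g \<in> E. w \<in> g} = {g, h}" "g \<noteq> h"
      by (auto simp: card_2_iff)
    moreover from this have "e = g \<or> e = h"
      using w e by blast
    ultimately show ?thesis by auto
  qed
  obtain f where f: "f \<noteq> e" "{g \<in> E. u \<in> g} = {e, f}"
    using other[of u] uv by auto
  obtain h where h: "h \<noteq> e" "{g \<in> E. v \<in> g} = {e, h}"
    using other[of v] uv by auto
  have "f \<noteq> h"
  proof
    assume "f = h"
    then have "{u, v} \<subseteq> f" "f \<in> E"
      using f h by blast+
    then have "f = e"
      using card_2_eqI[of f u v] G(4) uv by simp
    with f show False by simp
  qed
  have "{g \<in> E. adjacent e g} = ({g \<in> E. u \<in> g} \<union> {g \<in> E. v \<in> g}) - {e}"
    unfolding adjacent_def uv by auto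
  also have "\<dots> = {f, h}"
    unfolding f(2) h(2) using f(1) h(1) by auto
  finally show "card {g \<in> E. adjacent e g} = 2"
    using \<open>f \<noteq> h\<close> by simp
qed (auto simp: adjacent_def)

section \<open>Places of the slots in the cyclic order\<close>

text \<open>The first \<open>n mod 3\<close> thirds are longer by one, so third \<open>c\<close>
  starts at \<open>c * (n div 3) + min c (n mod 3)\<close>; the level is added to this
  start.\<close>

definition pos3 :: "nat \<Rightarrow> nat \<Rightarrow> nat" where
  "pos3 n s = (s mod 3) * (n div 3) + min (s mod 3) (n mod 3) + s div 3"

definition pos2 :: "nat \<Rightarrow> nat \<Rightarrow> nat" where
  "pos2 n s = (s mod 2) * (n div 2) + s div 2"

text \<open>The inequalities of \<open>le_cyclic_dist_iff\<close> for arbitrary places: both arcs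
  between \<open>p\<close> and \<open>q\<close> have length at least \<open>s\<close>.\<close>

definition cyclically_far :: "nat \<Rightarrow> nat \<Rightarrow> nat \<Rightarrow> nat \<Rightarrow> bool" where
  "cyclically_far n s p q \<longleftrightarrow> p + s \<le> q \<and> q + s \<le> n + p \<or> q + s \<le> p \<and> p + s \<le> n + q"

text \<open>Let \<open>x < y\<close>, \<open>c = x mod 3\<close> and \<open>r = n mod 3\<close>. A
  difference of 1 modulo 3 leads to the next third without loss of level, or from the last third to
  the first with a gain of level. A step by two from \<open>c = 0\<close> leads to the last third at
  the same level, one third away going backwards. From \<open>c > 0\<close> it leads back one third
  and up one level; the place lost is regained from the extra place of third \<open>c - 1\<close>,
  present because \<open>c \<le> r\<close>.\<close>

lemma cyclically_far_pos3:
  assumes "slot3 (Suc (n mod 3)) x y" "x < n" "y < n"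
  shows "cyclically_far n (n div 3) (pos3 n x) (pos3 n y)"
proof -
  have *: "cyclically_far n (n div 3) (pos3 n x) (pos3 n y) \<and> cyclically_far n (n div 3) (pos3 n y) (pos3 n x)"
    if xy: "x < y" "y < n" "(y - x) mod 3 = 1 \<or> y = x + 2 \<and> x mod 3 < Suc (n mod 3)" for x y
  proof -
    define t r a b c d where "t = n div 3" "r = n mod 3" "a = x div 3" "b = y div 3"
      "c = x mod 3" "d = y mod 3"
    note defs = this
    have eqs: "n = 3 * t + r" "r < 3" "y = 3 * b + d" "x = 3 * a + c" "c < 3" "d < 3"
      unfolding defs by simp_all
    obtain j where "y = x + 3 * j + 1 \<or> y = x + 2 \<and> c \<le> r"
    proof (cases "(y - x) mod 3 = 1")
      case True
      then have "y - x = 3 * ((y - x) div 3) + 1"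
        using mult_div_mod_eq[of 3 "y - x"] by simp
      then show ?thesis using that[of "(y - x) div 3"] xy(1) by linarith
    next
      case False
      then show ?thesis using that[of 0] xy(3) unfolding defs by auto
    qed
    then have "d = (c + 1) mod 3 \<and> 3 * b + d = 3 * a + c + 3 * j + 1 \<or>
      d = (c + 2) mod 3 \<and> 3 * b + d = 3 * a + c + 2 \<and> c \<le> r"
    proof (elim disjE conjE)
      assume "y = x + 3 * j + 1"
      then have "3 * b + d = c + 1 + 3 * (a + j)"
        using eqs by simp
      then have "(3 * b + d) mod 3 = (c + 1 + 3 * (a + j)) mod 3"
        by (rule arg_cong)
      then have "d = (c + 1) mod 3"
        using eqs(6) unfolding mod_mult_self2 by simp
      then show ?thesis
        using \<open>y = x + 3 * j + 1\<close> eqs by simp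
    next
      assume "y = x + 2" "c \<le> r"
      then have "3 * b + d = c + 2 + 3 * a"
        using eqs by simp
      then have "(3 * b + d) mod 3 = (c + 2 + 3 * a) mod 3"
        by (rule arg_cong)
      then have "d = (c + 2) mod 3"
        using eqs(6) unfolding mod_mult_self2 by simp
      then show ?thesis
        using \<open>y = x + 2\<close> \<open>c \<le> r\<close> eqs by simp
    qed
    moreover have "c = 0 \<or> c = 1 \<or> c = 2"
      using eqs by auto
    ultimately have "(c = 0 \<and> d = 1 \<or> c = 1 \<and> d = 2) \<and> a \<le> b \<or> c = 2 \<and> d = 0 \<and> a < b \<or>
      c = 0 \<and> d = 2 \<and> a = b \<or> c = 1 \<and> d = 0 \<and> b = a + 1 \<and> r \<ge> 1 \<or>
      c = 2 \<and> d = 1 \<and> b = a + 1 \<and> r \<ge> 2"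
      by (elim disjE conjE) auto
    then show ?thesis
      using xy(1,2) eqs unfolding cyclically_far_def pos3_def defs(1-6)[symmetric] by (elim disjE conjE) auto
  qed
  show ?thesis
    using assms *[of x y] *[of y x] unfolding slot3_def by blast
qed

lemma pos3_bij: "bij_betw (pos3 n) {..<n} {..<n}"
proof -
  define t r where "t = n div 3" "r = n mod 3"
  note tr = this
  have n: "n = 3 * t + r" "r < 3"
    unfolding tr by simp_all
  have "pos3 n x < n" if "x < n" for x
  proof -
    define a c where "a = x div 3" "c = x mod 3"
    note ac = this
    have "x = 3 * a + c" "c = 0 \<or> c = 1 \<or> c = 2"
      unfolding ac by (simp, presburger)
    then show ?thesis
      using that n unfolding pos3_def ac[symmetric] tr[symmetric] by auto
  qed
  moreover have "x = y" if "x < n" "y < n" "pos3 n x = pos3 n y" for x y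
  proof -
    define a b c d where "a = x div 3" "b = y div 3" "c = x mod 3" "d = y mod 3"
    note defs = this
    have "x = 3 * a + c" "c = 0 \<or> c = 1 \<or> c = 2" "y = 3 * b + d" "d = 0 \<or> d = 1 \<or> d = 2"
      unfolding defs by (simp, presburger, simp, presburger)
    then show ?thesis
      using that n unfolding pos3_def defs[symmetric] tr[symmetric] by auto
  qed
  ultimately have "pos3 n ` {..<n} \<subseteq> {..<n}" "inj_on (pos3 n) {..<n}"
    by (auto simp: inj_on_def)
  then show ?thesis
    by (simp add: bij_betw_def endo_inj_surj)
qed

text \<open>Slots of equal level in the two halves are \<open>n div 2\<close> apart in both
  directions; a level difference of one shortens one arc by one.\<close>

lemma cyclically_far_pos2:
  assumes "slot2 x y" "x < n" "y < n" "even n"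
  shows "cyclically_far n (n div 2 - 1) (pos2 n x) (pos2 n y)"
proof -
  have *: "cyclically_far n (n div 2 - 1) (pos2 n x) (pos2 n y) \<and> cyclically_far n (n div 2 - 1) (pos2 n y) (pos2 n x)"
    if xy: "y < n" "y = x + 1 \<or> even x \<and> y = x + 3" for x y
  proof (cases "even x")
    case True
    then obtain a where "x = 2 * a" by blast
    moreover obtain t where "n = 2 * t" using assms(4) by blast
    ultimately show ?thesis using xy unfolding cyclically_far_def pos2_def by auto
  next
    case False
    then obtain a where "x = 2 * a + 1" by (rule oddE)
    moreover obtain t where "n = 2 * t" using assms(4) by blast
    ultimately show ?thesis using xy False unfolding cyclically_far_def pos2_def by auto
  qed
  show ?thesis
    using assms *[of x y] *[of y x] unfolding slot2_def by blast
qed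

lemma pos2_bij:
  assumes "even n"
  shows "bij_betw (pos2 n) {..<n} {..<n}"
proof -
  obtain t where n: "n = 2 * t" using assms by blast
  have "pos2 n x < n" if "x < n" for x
    using that n by (cases "even x") (auto simp: pos2_def elim!: evenE oddE)
  moreover have "x = y" if "x < n" "y < n" "pos2 n x = pos2 n y" for x y
    using that n
    by (cases "even x"; cases "even y") (auto simp: pos2_def elim!: evenE oddE)
  ultimately have "pos2 n ` {..<n} \<subseteq> {..<n}" "inj_on (pos2 n) {..<n}"
    by (auto simp: inj_on_def)
  then show ?thesis
    by (simp add: bij_betw_def endo_inj_surj)
qed

lemma cyclically_far_sym: "cyclically_far n s p q \<Longrightarrow> cyclically_far n s q p"
  unfolding cyclically_far_def by blast

section \<open>Lower bounds\<close>

text \<open>The common part of both lower bounds: a packing gives slots to the edges, and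
  \<open>pos\<close> turns slots into places. The packing may use that the lists are cycles of
  adjacent edges, from which evenness of their lengths is derived in the class 1 case.\<close>

lemma cms_graph_ge_packing:
  assumes G: "regular_graph 2 V E"
    and packing: "\<And>cs. \<lbrakk>distinct (concat cs); set (concat cs) = E;
      \<And>c. c \<in> set cs \<Longrightarrow> length c \<ge> 3;
      \<And>c i. c \<in> set cs \<Longrightarrow> i < length c \<Longrightarrow> adjacent (c ! i) (c ! (Suc i mod length c))\<rbrakk>
      \<Longrightarrow> fits P (mset (map length cs)) 0"
    and pos: "bij_betw pos {..<card V} {..<card V}"
    and far: "\<And>x y. P x y \<Longrightarrow> x < card V \<Longrightarrow> y < card V \<Longrightarrow> cyclically_far (card V) s (pos x) (pos y)"
    and s: "1 \<le> s" "s \<le> card V"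
  shows "s \<le> cms_graph E"
proof -
  note fin = regular_2_graphD[OF G]
  have card: "card E = card V"
    by (rule regular_2_card[OF G])
  obtain cs where cs: "distinct (concat cs)" "set (concat cs) = E"
    "\<forall>c\<in>set cs. length c \<ge> 3 \<and> (\<forall>i<length c. adjacent (c ! i) (c ! (Suc i mod length c)))"
    "\<forall>x\<in>E. \<forall>y\<in>E. adjacent x y \<longrightarrow> (\<exists>c\<in>set cs. consecutive c x y \<or> consecutive c y x)"
    using cycle_decomposition[OF fin(2) regular_2_two_neighbours[OF G]] by blast
  have "fits P (mset (map length cs)) 0"
    using cs(1-3) by (intro packing) blast+
  then obtain f where "bij_betw f (set (concat cs)) {..<card (set (concat cs))}"
    and P: "\<And>c x y. c \<in> set cs \<Longrightarrow> consecutive c x y \<Longrightarrow> P (f x) (f y)"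
    using cs(1) by (rule fits_assignment) (rule that; assumption)
  then have f: "bij_betw f E {..<card V}"
    unfolding cs(2) card by simp
  have ord: "is_ordering E (pos \<circ> f)"
    using bij_betw_trans[OF f pos] unfolding is_ordering_def card .
  have "separated E (pos \<circ> f) s"
    unfolding separated_def
  proof (intro ballI impI)
    fix x y assume xy: "x \<in> E" "y \<in> E" "adjacent x y"
    have "f x < card V" "f y < card V"
      using f xy(1,2) unfolding bij_betw_def by auto
    moreover have "P (f x) (f y) \<or> P (f y) (f x)"
      using cs(4) P xy by blast
    ultimately have "cyclically_far (card V) s (pos (f x)) (pos (f y))"
      using far cyclically_far_sym by blast
    then show "s \<le> cyclic_dist E (pos \<circ> f) x y"
      using xy unfolding cyclically_far_def by (subst le_cyclic_dist_iff[OF ord]) (auto simp: card adjacent_def)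
  qed
  then show ?thesis
    using cms_graph_geI[OF fin(2) ord] s card by simp
qed

lemma cms_graph_ge_third:
  assumes G: "regular_graph 2 V E" and n: "card V \<ge> 3"
  shows "card V div 3 \<le> cms_graph E"
proof (rule cms_graph_ge_packing[OF G _ pos3_bij cyclically_far_pos3])
  fix cs :: "'a set list list"
  assume cs: "distinct (concat cs)" "set (concat cs) = E" "\<And>c. c \<in> set cs \<Longrightarrow> length c \<ge> 3"
  have "sum_mset (mset (map length cs)) = card V"
    using distinct_card[OF cs(1)] cs(2) regular_2_card[OF G]
    by (simp add: length_concat flip: sum_mset_sum_list)
  then show "fits (slot3 (Suc (card V mod 3))) (mset (map length cs)) 0"
    using fits_slot3[of "mset (map length cs)"] cs(3) by fastforce
qed (use n in auto)

text \<open>The two colours alternate along the list, also from its last entry back to its first, so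
  going round takes an even number of steps.\<close>

lemma even_cycle_length:
  assumes "length c > 0" "\<And>i. i < length c \<Longrightarrow> col (c ! i) \<in> {0, 1::nat}"
    "\<And>i. i < length c \<Longrightarrow> col (c ! i) \<noteq> col (c ! (Suc i mod length c))"
  shows "even (length c)"
proof -
  have "col (c ! i) = (col (c ! 0) + i) mod 2" if "i < length c" for i
    using that
  proof (induction i)
    case 0
    then show ?case using assms(2)[of 0] by auto
  next
    case (Suc i)
    then show ?case
      using assms(2)[of i] assms(2)[of "Suc i"] assms(3)[of i] by (auto simp: mod_Suc split: if_splits)
  qed
  from this[of "length c - 1"] show ?thesis
    using assms(1) assms(2)[of 0] assms(3)[of "length c - 1"]
    by (cases "length c") (auto simp: even_iff_mod_2_eq_zero mod_Suc split: if_splits)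
qed

lemma cms_graph_ge_class1:
  assumes G: "class1 2 V E" and n: "card V \<ge> 4" "even (card V)"
  shows "card V div 2 - 1 \<le> cms_graph E"
proof -
  have reg: "regular_graph 2 V E"
    using G unfolding class1_def by simp
  obtain col where "proper_edge_colouring 2 E col"
    using G unfolding class1_def by blast
  then have col: "col ` E \<subseteq> {..<2}"
    "\<And>e e'. e \<in> E \<Longrightarrow> e' \<in> E \<Longrightarrow> adjacent e e' \<Longrightarrow> col e \<noteq> col e'"
    unfolding proper_edge_colouring_def by blast+
  show ?thesis
  proof (rule cms_graph_ge_packing[OF reg _ pos2_bij cyclically_far_pos2])
    fix cs :: "'a set list list"
    assume cs: "set (concat cs) = E" "\<And>c. c \<in> set cs \<Longrightarrow> length c \<ge> 3"
      "\<And>c i. c \<in> set cs \<Longrightarrow> i < length c \<Longrightarrow> adjacent (c ! i) (c ! (Suc i mod length c))"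
    have "even (length c)" if c: "c \<in> set cs" for c
    proof (rule even_cycle_length)
      show pos: "length c > 0" using cs(2)[OF c] by linarith
      have mem: "c ! i \<in> E" if "i < length c" for i
        using c cs(1) that by auto
      show "col (c ! i) \<in> {0, 1}" if "i < length c" for i
        using mem[OF that] col(1) by (auto simp: less_2_cases_iff)
      show "col (c ! i) \<noteq> col (c ! (Suc i mod length c))" if "i < length c" for i
        using col(2) mem cs(3)[OF c that] that pos by simp
    qed
    then show "fits slot2 (mset (map length cs)) 0"
      using cs(2) by (intro fits_slot2) force+
  qed (use n in auto)
qed

section \<open>Upper bounds and extremal graphs\<close>

text \<open>Three places cut the cyclic order into three arcs of total length \<open>card E\<close>,
  each of length at least \<open>s\<close>.\<close>

lemma separated_triangle:
  assumes "is_ordering E l" "separated E l s" "e \<in> E" "f \<in> E" "g \<in> E"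
    "adjacent e f" "adjacent f g" "adjacent g e"
  shows "3 * s \<le> card E"
proof -
  have "s \<le> cyclic_dist E l e f" "s \<le> cyclic_dist E l f g" "s \<le> cyclic_dist E l g e"
    using assms unfolding separated_def by blast+
  moreover have "e \<noteq> f" "f \<noteq> g" "g \<noteq> e"
    using assms unfolding adjacent_def by auto
  ultimately show ?thesis
    unfolding le_cyclic_dist_iff[OF assms(1,3,4) \<open>e \<noteq> f\<close>]
      le_cyclic_dist_iff[OF assms(1,4,5) \<open>f \<noteq> g\<close>] le_cyclic_dist_iff[OF assms(1,5,3) \<open>g \<noteq> e\<close>]
    by linarith
qed

text \<open>If \<open>2 * s\<close> were at least \<open>card E\<close>, only the place opposite to
  \<open>e\<close> could hold a neighbour, which leaves no room for two.\<close>

lemma separated_two_neighbours: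
  assumes "is_ordering E l" "separated E l s" "e \<in> E" "f \<in> E" "g \<in> E"
    "adjacent e f" "adjacent e g" "f \<noteq> g"
  shows "2 * s < card E"
proof -
  have "s \<le> cyclic_dist E l e f" "s \<le> cyclic_dist E l e g"
    using assms unfolding separated_def by blast+
  moreover have "e \<noteq> f" "e \<noteq> g"
    using assms unfolding adjacent_def by auto
  moreover have "l f \<noteq> l g" "l f < card E" "l g < card E"
    using is_orderingD[OF assms(1)] assms by auto
  ultimately show ?thesis
    unfolding le_cyclic_dist_iff[OF assms(1,3,4) \<open>e \<noteq> f\<close>]
      le_cyclic_dist_iff[OF assms(1,3,5) \<open>e \<noteq> g\<close>]
    by linarith
qed

lemma cms_graph_le_half:
  assumes G: "regular_graph 2 V E" and "V \<noteq> {}"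
  shows "cms_graph E \<le> (card V - 1) div 2"
proof (rule cms_graph_leI)
  note fin = regular_2_graphD[OF G]
  show "finite E" by (rule fin(2))
  have "card V > 0"
    using assms(2) fin(1) by (simp add: card_gt_0_iff)
  then show "E \<noteq> {}"
    using regular_2_card[OF G] by auto
  then obtain e where e: "e \<in> E" by blast
  then have "card {f \<in> E. adjacent e f} = 2"
    using regular_2_two_neighbours[OF G] unfolding two_neighbours_def by blast
  then obtain f g where "{f \<in> E. adjacent e f} = {f, g}" "f \<noteq> g"
    by (auto simp: card_2_iff)
  then have fg: "f \<in> E" "g \<in> E" "adjacent e f" "adjacent e g" "f \<noteq> g"
    by blast+
  show "s \<le> (card V - 1) div 2" if "is_ordering E l" "separated E l s" for l s
    using separated_two_neighbours[OF that e fg] regular_2_card[OF G] by simp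
qed

section \<open>Graphs from permutations\<close>

text \<open>A vertex lies on the edge to its image and on the edge from its preimage. Without fixed
  points there are no loops, and without 2-cycles these two edges differ.\<close>

lemma regular_2_graph_of_bij:
  assumes fin: "finite V" and bij: "bij_betw \<sigma> V V"
    and \<sigma>: "\<And>v. v \<in> V \<Longrightarrow> \<sigma> v \<noteq> v" "\<And>v. v \<in> V \<Longrightarrow> \<sigma> (\<sigma> v) \<noteq> v"
  shows "regular_graph 2 V ((\<lambda>v. {v, \<sigma> v}) ` V)"
  unfolding regular_graph_def simple_graph_def
proof (intro conjI ballI)
  have mem: "\<sigma> v \<in> V" if "v \<in> V" for v
    using bij that unfolding bij_betw_def by blast
  fix e assume "e \<in> (\<lambda>v. {v, \<sigma> v}) ` V"
  then obtain v where v: "v \<in> V" "e = {v, \<sigma> v}" by blast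
  then show "e \<subseteq> V"
    using mem by simp
  show "card e = 2"
    using \<sigma>(1)[OF v(1)] unfolding v(2) by simp
next
  fix v assume v: "v \<in> V"
  then have "v \<in> \<sigma> ` V"
    using bij by (simp add: bij_betw_def)
  then obtain w where w: "w \<in> V" "\<sigma> w = v"
    by auto
  have inj: "x = y" if "\<sigma> x = \<sigma> y" "x \<in> V" "y \<in> V" for x y
    using bij that unfolding bij_betw_def inj_on_def by blast
  have "{e \<in> (\<lambda>v. {v, \<sigma> v}) ` V. v \<in> e} = {{v, \<sigma> v}, {w, v}}"
    using v w inj by blast
  moreover have "{v, \<sigma> v} \<noteq> {w, v}"
    using \<sigma> w by (metis doubleton_eq_iff)
  ultimately show "degree ((\<lambda>v. {v, \<sigma> v}) ` V) v = 2"
    unfolding degree_def by simp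
qed (rule fin)

lemma bij_betw_lessThanI:
  assumes "\<And>i. i < n \<Longrightarrow> \<sigma> i < (n::nat)" "\<And>i j. i < n \<Longrightarrow> j < n \<Longrightarrow> \<sigma> i = \<sigma> j \<Longrightarrow> i = j"
  shows "bij_betw \<sigma> {..<n} {..<n}"
proof -
  have "\<sigma> ` {..<n} \<subseteq> {..<n}" "inj_on \<sigma> {..<n}"
    using assms by (auto simp: inj_on_def)
  then show ?thesis
    by (simp add: bij_betw_def endo_inj_surj)
qed

text \<open>The witness is the disjoint union of a triangle and a cycle of length \<open>n - 3\<close>.\<close>

lemma regular_2_triangle_exists:
  assumes "n \<ge> 6"
  obtains V :: "nat set" and E where "regular_graph 2 V E" "card V = n" "cms_graph E \<le> n div 3"
proof -
  \<comment> \<open>\<open>\<sigma>\<close> rotates 0, 1, 2 and, separately, 3 up to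
    \<open>n - 1\<close>; by \<open>n \<ge> 6\<close> the second cycle also has at least three
    vertices.\<close>
  define \<sigma> where "\<sigma> i = (if i = 2 then 0 else if i = n - 1 then 3 else i + 1)" for i :: nat
  define E where "E = (\<lambda>i. {i, \<sigma> i}) ` {..<n}"
  have bij: "bij_betw \<sigma> {..<n} {..<n}"
    using assms by (intro bij_betw_lessThanI) (auto simp: \<sigma>_def split: if_splits)
  have reg: "regular_graph 2 {..<n} E"
    unfolding E_def using assms
    by (intro regular_2_graph_of_bij bij) (auto simp: \<sigma>_def split: if_splits)
  have tri: "{0, 1} \<in> E" "{1, 2} \<in> E" "{2, 0} \<in> E"
  proof -
    have "{0, \<sigma> 0} \<in> E" "{1, \<sigma> 1} \<in> E" "{2, \<sigma> 2} \<in> E"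
      using assms unfolding E_def by auto
    moreover have "\<sigma> 0 = 1" "\<sigma> 1 = 2" "\<sigma> 2 = 0"
      using assms by (auto simp: \<sigma>_def)
    ultimately show "{0, 1} \<in> E" "{1, 2} \<in> E" "{2, 0} \<in> E"
      by simp_all
  qed
  have "card E = n"
    using regular_2_card[OF reg] by simp
  moreover have "cms_graph E \<le> card E div 3"
  proof (rule cms_graph_leI)
    show "s \<le> card E div 3" if "is_ordering E l" "separated E l s" for l s
      using separated_triangle[OF that tri] by (simp add: adjacent_def doubleton_eq_iff)
  qed (use regular_2_graphD[OF reg] tri in auto)
  ultimately show ?thesis
    using that[OF reg] by simp
qed

text \<open>An even cycle with alternately coloured edges; it makes the set under the minimum in
  \<open>cms1\<close> nonempty.\<close>

lemma class1_cycle: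
  assumes "n \<ge> 4" "even n"
  obtains V :: "nat set" and E where "class1 2 V E" "card V = n"
proof -
  define \<sigma> where "\<sigma> i = (if i = n - 1 then 0 else i + 1)" for i :: nat
  define edge where "edge i = {i, \<sigma> i}" for i
  have bij: "bij_betw \<sigma> {..<n} {..<n}"
    using assms by (intro bij_betw_lessThanI) (auto simp: \<sigma>_def split: if_splits)
  have \<sigma>\<sigma>: "\<sigma> (\<sigma> i) \<noteq> i" "\<sigma> i \<noteq> i" if "i < n" for i
    using assms(1) that by (auto simp: \<sigma>_def split: if_splits)
  have reg: "regular_graph 2 {..<n} (edge ` {..<n})"
    unfolding edge_def using bij \<sigma>\<sigma> by (intro regular_2_graph_of_bij) auto
  \<comment> \<open>Two indices with the same edge would be swapped by
    \<open>\<sigma>\<close>.\<close>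
  have inj: "inj_on edge {..<n}"
    unfolding inj_on_def edge_def by (metis \<sigma>\<sigma>(1) doubleton_eq_iff lessThan_iff)
  \<comment> \<open>At the wrap from \<open>n - 1\<close> to 0 the parity changes because
    \<open>n\<close> is even.\<close>
  have parity: "\<sigma> i mod 2 \<noteq> i mod 2" if "i < n" for i
    using assms that by (auto simp: \<sigma>_def mod_Suc)
  define col where "col e = inv_into {..<n} edge e mod 2" for e
  have col: "col (edge i) = i mod 2" if "i < n" for i
    unfolding col_def using inv_into_f_f[OF inj] that by simp
  have "proper_edge_colouring 2 (edge ` {..<n}) col"
    unfolding proper_edge_colouring_def
  proof (intro conjI ballI impI)
    show "col ` edge ` {..<n} \<subseteq> {..<2}"
      by (auto simp: col_def)
    fix e e' assume "e \<in> edge ` {..<n}" "e' \<in> edge ` {..<n}" and adj: "adjacent e e'"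
    then obtain i j where ij: "i < n" "j < n" "e = edge i" "e' = edge j" by auto
    have "i \<noteq> j"
      using adj ij unfolding adjacent_def by auto
    then have "\<sigma> i \<noteq> \<sigma> j"
      using bij ij(1,2) unfolding bij_betw_def inj_on_def by auto
    then have "j = \<sigma> i \<or> i = \<sigma> j"
      using adj \<open>i \<noteq> j\<close> unfolding adjacent_def ij edge_def by auto
    then show "col e \<noteq> col e'"
      using ij col parity by metis
  qed
  then have "class1 2 {..<n} (edge ` {..<n})"
    using reg unfolding class1_def by blast
  then show ?thesis
    using that by simp
qed

section \<open>The two minima\<close>

lemma cms_eq:
  assumes "n \<ge> 6"
  shows "cms n 2 = n div 3"
  unfolding cms_def
proof (rule Min_eqI)
  let ?S = "{cms_graph E | (V :: nat set) E. regular_graph 2 V E \<and> card V = n}"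
  have "V \<noteq> {}" if "card V = n" for V :: "nat set"
    using that assms by auto
  \<comment> \<open>The bound by one half serves here to make the set of values finite.\<close>
  then have "?S \<subseteq> {..(n - 1) div 2}"
    using cms_graph_le_half by blast
  then show "finite ?S"
    by (rule finite_subset) simp
  show "n div 3 \<le> s" if "s \<in> ?S" for s
    using that assms cms_graph_ge_third by fastforce
  obtain V :: "nat set" and E where
    VE: "regular_graph 2 V E" "card V = n" "cms_graph E \<le> n div 3"
    using regular_2_triangle_exists[OF assms] .
  then have "n div 3 = cms_graph E"
    using cms_graph_ge_third[of V E] assms by simp
  then show "n div 3 \<in> ?S"
    using VE by blast
qed

text \<open>For even \<open>n\<close> the upper bound for all 2-regular graphs meets the lower bound
  for class 1 graphs, so the minimum is over a singleton.\<close>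

lemma cms1_eq:
  assumes "n \<ge> 4" "even n"
  shows "cms1 n 2 = n div 2 - 1"
proof -
  have eq: "cms_graph E = n div 2 - 1" if "class1 2 V E" "card V = n" for V :: "nat set" and E
  proof (rule antisym)
    have "(n - 1) div 2 = n div 2 - 1"
      using assms by (auto elim!: evenE)
    moreover have "V \<noteq> {}"
      using that(2) assms(1) by auto
    ultimately show "cms_graph E \<le> n div 2 - 1"
      using cms_graph_le_half[of V E] that unfolding class1_def by simp
    show "n div 2 - 1 \<le> cms_graph E"
      using cms_graph_ge_class1[OF that(1)] that(2) assms by simp
  qed
  obtain V :: "nat set" and E where VE: "class1 2 V E" "card V = n"
    using class1_cycle[OF assms] .
  then have "cms_graph E \<in> {cms_graph E | (V :: nat set) E. class1 2 V E \<and> card V = n}"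
    by blast
  moreover have "{cms_graph E | (V :: nat set) E. class1 2 V E \<and> card V = n} \<subseteq> {n div 2 - 1}"
    using eq by blast
  ultimately have "{cms_graph E | (V :: nat set) E. class1 2 V E \<and> card V = n} = {n div 2 - 1}"
    using eq[OF VE] by auto
  then show ?thesis
    unfolding cms1_def by simp
qed

theorem theorem1p2:
  shows "(\<forall>n::nat. n \<ge> 6 \<longrightarrow> int (cms n 2) = \<lfloor>real n / 3\<rfloor>) \<and>
         (\<forall>n::nat. n \<ge> 4 \<and> even n \<longrightarrow> real (cms1 n 2) = (real n - 2) / 2)"
proof (intro conjI allI impI)
  show "int (cms n 2) = \<lfloor>real n / 3\<rfloor>" if "n \<ge> 6" for n
    using floor_divide_of_nat_eq[where 'a = real, of n 3] cms_eq[OF that] by simp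
  show "real (cms1 n 2) = (real n - 2) / 2" if n: "n \<ge> 4 \<and> even n" for n
  proof -
    obtain h where "n = 2 * h" using n by blast
    then show ?thesis using cms1_eq[of n] n by (simp add: of_nat_diff)
  qed
qed

end
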